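(* Let $\beta=\eta_r^2\lambda_m^2/2$, $\gamma=\eta_e^2/2$, $A=\eta_d^2/(\eta_r^2\lambda_m^2T_q)$ and $\eta=e^{-\alpha L}$. The rate-versus-distance function $R^{(0)}(L)$ achieved by the repeater chain when all detector dark-click probabilities are zero and an appropriate number of elementary links is used for a given range $L$ (that is, the envelope of the rates $R_N^{(0)}(L)$ over all $N\ge1$, see context) is exactly given by $$R^{(0)}(L)=A\,\eta^{\xi},\qquad \xi=\frac{\log\left[\beta\left(1-(1-\gamma z)^M\right)\right]}{\log z},$$ where $z$ is the unique solution in the interval $(0,1)$ of the transcendental equation $$\left(1-(1-\gamma z)^M\right)\log\left[\beta\left(1-(1-\gamma z)^M\right)\right]=\gamma Mz\,\log z\,(1-\gamma z)^{M-1}.$$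
   Context: Parameters: $M\ge1$ is the (integer) number of frequency modes; $\alpha>0$ is the fiber loss coefficient; $T_q>0$ is the qubit duration; $\eta_e,\eta_r,\eta_d\in(0,1]$ are the efficiencies of the detectors at the elementary-link centers, the repeater nodes and the two end stations; $\lambda_m\in(0,1]$ is the memory efficiency. When all detector dark-click probabilities are zero, the secret-key rate of a repeater chain with $N$ equal-length elementary links over total range $L$, with total transmittance $\eta=e^{-\alpha L}$, is $$R_N^{(0)}(L)=A\left[\beta\left(1-\left(1-\gamma\,\eta^{1/N}\right)^M\right)\right]^N .$$ The envelope over $N\ge1$ is taken in the sense of envelopes of a one-parameter family of curves, with $t=1/N\in(0,1]$ treated as a continuous parameter: writing $x=\eta$ for the transmittance, $y$ for the rate and $$f(x,y,t)=\left(\frac yA\right)^t-\beta\left(1-(1-\gamma x^t)^M\right),$$ the envelope is given by the simultaneous solution of $f(x,y,t)=0$ and $\partial f(x,y,t)/\partial t=0$, and $R^{(0)}(L)$ is the value $y$ on it at $x=e^{-\alpha L}$.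
   Formalization: A solution z in (0,1) exists (and is then unique) exactly when βγM>1; the formula is proved for such parameters and L>0. With t in (0,1] the envelope has a point exactly when η≤z and the formula is given there; with all t>0 allowed it holds for every L>0. *)

theory Defs
  imports Complex_Main
begin

text \<open>
  Secret-key rate of a chain of \<open>N\<close> equal elementary links over total range \<open>L\<close> with zero
  dark-click probabilities; the total transmittance is \<open>exp (- \<alpha> * L)\<close>.
\<close>

definition chain_rate ::
    "real \<Rightarrow> real \<Rightarrow> real \<Rightarrow> nat \<Rightarrow> real \<Rightarrow> nat \<Rightarrow> real \<Rightarrow> real" where
  "chain_rate A \<beta> \<gamma> M \<alpha> N L =
     A * (\<beta> * (1 - (1 - \<gamma> * exp (- \<alpha> * L) powr (1 / real N)) ^ M)) ^ N"

text \<open>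
  The one-parameter family of curves in the (transmittance, rate) plane; its member with
  \<open>t = 1 / N\<close> is the graph of \<open>chain_rate\<close> for \<open>N\<close> links (lemma \<open>rate_family_zero_iff\<close> below).
\<close>

definition rate_family ::
    "real \<Rightarrow> real \<Rightarrow> real \<Rightarrow> nat \<Rightarrow> real \<Rightarrow> real \<Rightarrow> real \<Rightarrow> real" where
  "rate_family A \<beta> \<gamma> M x y t = (y / A) powr t - \<beta> * (1 - (1 - \<gamma> * x powr t) ^ M)"

lemma rate_family_zero_iff:
  assumes "0 < A" "0 < \<beta>" "0 < \<gamma>" "\<gamma> < 1" "1 \<le> M" "1 \<le> N" "0 < \<alpha>" "0 < L" "0 < y"
  shows "rate_family A \<beta> \<gamma> M (exp (- \<alpha> * L)) y (1 / real N) = 0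
           \<longleftrightarrow> y = chain_rate A \<beta> \<gamma> M \<alpha> N L"
proof -
  define p where "p = exp (- \<alpha> * L) powr (1 / real N)"
  define g where "g = \<beta> * (1 - (1 - \<gamma> * p) ^ M)"
  have p: "0 < p" "p \<le> 1"
    using assms by (simp_all add: p_def powr_def)
  have q: "\<gamma> * p \<le> \<gamma>" "0 < \<gamma> * p"
    using p assms by (simp_all add: mult_left_le)
  then have "0 \<le> 1 - \<gamma> * p" "1 - \<gamma> * p < 1"
    using assms by linarith+
  then have "(1 - \<gamma> * p) ^ M < 1 ^ M"
    using assms by (intro power_strict_mono) auto
  then have g: "0 < g"
    using assms by (simp add: g_def)
  have "(y / A) powr (1 / real N) = g \<longleftrightarrow> y / A = g ^ N"
  proof
    assume h: "(y / A) powr (1 / real N) = g"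
    have "g ^ N = g powr real N"
      using g by (rule powr_realpow[symmetric])
    also have "\<dots> = (y / A) powr (1 / real N * real N)"
      unfolding h[symmetric] by (rule powr_powr)
    also have "\<dots> = y / A"
      using assms by simp
    finally show "y / A = g ^ N" ..
  next
    assume h: "y / A = g ^ N"
    have "(g powr real N) powr (1 / real N) = g"
      using assms g by (simp only: powr_powr) simp
    then show "(y / A) powr (1 / real N) = g"
      unfolding h powr_realpow[OF g] .
  qed
  moreover have "y / A = g ^ N \<longleftrightarrow> y = A * g ^ N"
    using assms by (auto simp: field_simps)
  ultimately show ?thesis
    unfolding rate_family_def chain_rate_def g_def p_def by simp
qed

text \<open>
  Envelope of the family with parameter range \<open>T\<close>. The rate is required to be positive because
  \<open>y / A\<close> is raised to a real power. The derivative in the parameter is two-sided also at an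
  end point of \<open>T\<close>, since the family is defined for every real parameter.
\<close>

definition on_envelope ::
    "real \<Rightarrow> real \<Rightarrow> real \<Rightarrow> nat \<Rightarrow> real set \<Rightarrow> real \<Rightarrow> real \<Rightarrow> bool" where
  "on_envelope A \<beta> \<gamma> M T x y \<longleftrightarrow>
     0 < y \<and> (\<exists>t\<in>T. rate_family A \<beta> \<gamma> M x y t = 0 \<and>
                    (rate_family A \<beta> \<gamma> M x y has_real_derivative 0) (at t))"

definition envelope_rate ::
    "real \<Rightarrow> real \<Rightarrow> real \<Rightarrow> nat \<Rightarrow> real set \<Rightarrow> real \<Rightarrow> real \<Rightarrow> real" where
  "envelope_rate A \<beta> \<gamma> M T \<alpha> L = (THE y. on_envelope A \<beta> \<gamma> M T (exp (- \<alpha> * L)) y)"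

definition transcendental_root :: "real \<Rightarrow> real \<Rightarrow> nat \<Rightarrow> real \<Rightarrow> bool" where
  "transcendental_root \<beta> \<gamma> M z \<longleftrightarrow>
     0 < z \<and> z < 1 \<and>
     (1 - (1 - \<gamma> * z) ^ M) * ln (\<beta> * (1 - (1 - \<gamma> * z) ^ M))
       = \<gamma> * real M * z * ln z * (1 - \<gamma> * z) ^ (M - 1)"

definition rate_exponent :: "real \<Rightarrow> real \<Rightarrow> nat \<Rightarrow> real \<Rightarrow> real" where
  "rate_exponent \<beta> \<gamma> M z = ln (\<beta> * (1 - (1 - \<gamma> * z) ^ M)) / ln z"

end

theory Submission
  imports Defs "HOL-Real_Asymp.Real_Asymp"
begin

text \<open>
  Put \<open>g z = \<beta> (1 - (1 - \<gamma> z)\<^sup>M)\<close>. For \<open>u = ln z\<close> the function \<open>h u = ln (g (exp u))\<close> is concave,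
  strictly so for \<open>M \<ge> 2\<close>: its slope is \<open>M q\<^sup>M\<^sup>-\<^sup>1 / (1 + q + \<dots> + q\<^sup>M\<^sup>-\<^sup>1)\<close> with \<open>q = 1 - \<gamma> z\<close>.
  The transcendental equation says that the tangent of \<open>h\<close> at \<open>u\<close> passes through the origin,
  \<open>h u - u h' u = 0\<close>. By concavity the left-hand side decreases strictly in \<open>u < 0\<close>, from its limit
  \<open>ln (\<beta> \<gamma> M)\<close> at \<open>- \<infinity>\<close> to \<open>ln (g 1) < 0\<close> at \<open>0\<close>. The envelope conditions at transmittance \<open>\<eta>\<close>
  and parameter \<open>t\<close> reduce to the same equation for \<open>z = \<eta>\<^sup>t\<close>.
\<close>

text \<open>The strict bounds keep \<open>1 - \<gamma> * z\<close> positive and the gain below 1 on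
  all of (0, 1], the end point 1 included.\<close>

locale link_gain =
  fixes \<beta> \<gamma> :: real and M :: nat
  assumes \<beta>_pos: "0 < \<beta>" and \<beta>_less_1: "\<beta> < 1"
    and \<gamma>_pos: "0 < \<gamma>" and \<gamma>_less_1: "\<gamma> < 1"
    and M_pos: "1 \<le> M"
begin

section \<open>Gain of one link and its logarithm\<close>

definition gain :: "real \<Rightarrow> real" where
  "gain z = \<beta> * (1 - (1 - \<gamma> * z) ^ M)"

definition gain_deriv :: "real \<Rightarrow> real" where
  "gain_deriv z = \<beta> * (\<gamma> * real M * (1 - \<gamma> * z) ^ (M - 1))"

text \<open>The slope of \<open>h\<close>: the derivative of \<open>ln (gain z)\<close> with respect
  to \<open>ln z\<close>.\<close>

definition elasticity :: "real \<Rightarrow> real" where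
  "elasticity z = z * gain_deriv z / gain z"

text \<open>The height at which the tangent of \<open>h\<close> at \<open>u = ln z\<close> meets the
  axis \<open>u = 0\<close>.\<close>

definition tangent_offset :: "real \<Rightarrow> real" where
  "tangent_offset z = ln (gain z) - ln z * elasticity z"

lemma \<gamma>z_bounds:
  assumes "0 < z" "z \<le> 1"
  shows "0 < \<gamma> * z" "\<gamma> * z < 1"
proof -
  show "0 < \<gamma> * z" using assms \<gamma>_pos by simp
  have "\<gamma> * z \<le> \<gamma>" using assms \<gamma>_pos by (simp add: mult_left_le)
  then show "\<gamma> * z < 1" using \<gamma>_less_1 by simp
qed

lemma gain_bounds:
  assumes "0 < z" "z \<le> 1"
  shows "0 < gain z" "gain z < 1"
proof -
  note b = \<gamma>z_bounds[OF assms]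
  have "(1 - \<gamma> * z) ^ M < 1 ^ M"
    using b M_pos by (intro power_strict_mono) auto
  then show "0 < gain z" using \<beta>_pos by (simp add: gain_def)
  have "0 < (1 - \<gamma> * z) ^ M" using b by simp
  then have "gain z \<le> \<beta> * 1" unfolding gain_def using \<beta>_pos by (intro mult_left_mono) auto
  then show "gain z < 1" using \<beta>_less_1 by simp
qed

section \<open>Bounds and monotonicity of the slope\<close>

lemma has_real_derivative_gain: "(gain has_real_derivative gain_deriv z) (at z)"
  unfolding gain_def[abs_def] gain_deriv_def
  by (auto intro!: derivative_eq_intros simp: algebra_simps)

lemma gain_eq_sum: "gain z = \<beta> * (\<gamma> * z * (\<Sum>k<M. (1 - \<gamma> * z) ^ k))"
  unfolding gain_def one_diff_power_eq by simp

lemma elasticity_eq_sum: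
  assumes "0 < z"
  shows "elasticity z = real M * (1 - \<gamma> * z) ^ (M - 1) / (\<Sum>k<M. (1 - \<gamma> * z) ^ k)"
  unfolding elasticity_def gain_eq_sum gain_deriv_def
  using assms \<beta>_pos \<gamma>_pos by simp

lemma sum_power_pos:
  assumes "0 < z" "z \<le> 1"
  shows "0 < (\<Sum>k<M. (1 - \<gamma> * z) ^ k)"
  using \<gamma>z_bounds[OF assms] M_pos by (intro sum_pos) (auto simp: lessThan_empty_iff)

lemma sum_power_ge:
  assumes "0 < z" "z \<le> 1"
  shows "real M * (1 - \<gamma> * z) ^ (M - 1) \<le> (\<Sum>k<M. (1 - \<gamma> * z) ^ k)"
proof -
  have "real (card {..<M}) * (1 - \<gamma> * z) ^ (M - 1) \<le> (\<Sum>k<M. (1 - \<gamma> * z) ^ k)"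
    using \<gamma>z_bounds[OF assms] by (intro sum_bounded_below power_decreasing) auto
  then show ?thesis by simp
qed

lemma elasticity_le_1:
  assumes "0 < z" "z \<le> 1"
  shows "elasticity z \<le> 1"
  unfolding elasticity_eq_sum[OF assms(1)]
  using sum_power_pos[OF assms] sum_power_ge[OF assms] by simp

text \<open>The slope tends to 1 at 0 with at most a linear error, which is enough for
  \<open>ln z * (1 - elasticity z)\<close> to vanish there. The power sum is at most
  \<open>M\<close>, and Bernoulli bounds the remaining power from below.\<close>

lemma elasticity_ge:
  assumes "0 < z" "z \<le> 1"
  shows "1 - real M * z \<le> elasticity z"
proof -
  note b = \<gamma>z_bounds[OF assms]
  have "1 - real M * z \<le> 1 - real (M - 1) * (\<gamma> * z)"
  proof -
    have "real (M - 1) * (\<gamma> * z) \<le> real M * z"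
      using b assms \<gamma>_pos \<gamma>_less_1 by (intro mult_mono) auto
    then show ?thesis by simp
  qed
  also have "\<dots> \<le> (1 - \<gamma> * z) ^ (M - 1)"
    using Bernoulli_inequality[of "- (\<gamma> * z)" "M - 1"] b by simp
  also have "\<dots> \<le> real M * (1 - \<gamma> * z) ^ (M - 1) / (\<Sum>k<M. (1 - \<gamma> * z) ^ k)"
  proof -
    have "(\<Sum>k<M. (1 - \<gamma> * z) ^ k) \<le> (\<Sum>k<M. 1)"
      using b by (intro sum_mono power_le_one) auto
    then have "(1 - \<gamma> * z) ^ (M - 1) * (\<Sum>k<M. (1 - \<gamma> * z) ^ k) \<le> (1 - \<gamma> * z) ^ (M - 1) * real M"
      using b by (intro mult_left_mono) auto
    then show ?thesis
      using sum_power_pos[OF assms] by (simp add: pos_le_divide_eq mult.commute)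
  qed
  finally show ?thesis unfolding elasticity_eq_sum[OF assms(1)] .
qed

lemma elasticity_strict_antimono:
  assumes "2 \<le> M" "0 < x" "x < y" "y \<le> 1"
  shows "elasticity y < elasticity x"
proof -
  define p q where "p = 1 - \<gamma> * x" and "q = 1 - \<gamma> * y"
  have q: "0 < q" "q < p"
    using \<gamma>z_bounds[of y] assms \<gamma>_pos by (auto simp: p_def q_def)
  have S: "0 < (\<Sum>k<M. p ^ k)" "0 < (\<Sum>k<M. q ^ k)"
    using sum_power_pos assms by (auto simp: p_def q_def)
  have split: "r ^ (M - 1) = r ^ (M - 1 - k) * r ^ k" if "k < M" for r :: real and k
    using that by (simp flip: power_add)
  have "(\<Sum>k<M. q ^ (M - 1) * p ^ k) < (\<Sum>k<M. p ^ (M - 1) * q ^ k)"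
  proof (rule sum_strict_mono_ex1)
    show "\<forall>k\<in>{..<M}. q ^ (M - 1) * p ^ k \<le> p ^ (M - 1) * q ^ k"
    proof
      fix k assume "k \<in> {..<M}"
      then have k: "k < M" by simp
      \<comment> \<open>Splitting off the common factor \<open>q ^ k * p ^ k\<close> leaves only a
        comparison of the powers with exponent \<open>M - 1 - k\<close>.\<close>
      have "q ^ (M - 1 - k) * (q ^ k * p ^ k) \<le> p ^ (M - 1 - k) * (q ^ k * p ^ k)"
        using q by (intro mult_right_mono power_mono) auto
      then show "q ^ (M - 1) * p ^ k \<le> p ^ (M - 1) * q ^ k"
        unfolding split[OF k] by (simp add: mult_ac)
    qed
    \<comment> \<open>Strictness comes from the term \<open>k = 0\<close>, whose exponent
      \<open>M - 1\<close> is positive for two or more modes. For \<open>M = 1\<close> the slope is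
      constantly 1.\<close>
    have "q ^ (M - 1) < p ^ (M - 1)"
      using q assms by (intro power_strict_mono) auto
    then show "\<exists>k\<in>{..<M}. q ^ (M - 1) * p ^ k < p ^ (M - 1) * q ^ k"
      using M_pos by (intro bexI[of _ 0]) auto
  qed simp
  then have "q ^ (M - 1) * (\<Sum>k<M. p ^ k) < p ^ (M - 1) * (\<Sum>k<M. q ^ k)"
    by (simp add: sum_distrib_left)
  then have "q ^ (M - 1) / (\<Sum>k<M. q ^ k) < p ^ (M - 1) / (\<Sum>k<M. p ^ k)"
    using S by (simp add: frac_less_eq divide_less_eq less_divide_eq mult_ac)
  then show ?thesis
    using assms M_pos by (simp add: elasticity_eq_sum p_def q_def flip: times_divide_eq_right)
qed

section \<open>Monotonicity and boundary behaviour of the tangent offset\<close>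

lemma tangent_offset_strict_antimono:
  assumes M: "2 \<le> M" and xy: "0 < x" "x < y" "y < 1"
  shows "tangent_offset y < tangent_offset x"
proof -
  \<comment> \<open>With the slope frozen at \<open>x\<close>, \<open>\<phi> x\<close> is the offset
    at \<open>x\<close>, and \<open>\<phi>\<close> does not increase because the slope only falls to
    the right of \<open>x\<close>. This avoids differentiating the slope.\<close>
  define \<phi> where "\<phi> = (\<lambda>z. ln (gain z) - elasticity x * ln z)"
  have "\<phi> y \<le> \<phi> x"
  proof (rule DERIV_nonpos_imp_nonincreasing[of x y \<phi>])
    fix z assume z: "x \<le> z" "z \<le> y"
    have z01: "0 < z" "z \<le> 1" using z xy by auto
    have "(\<phi> has_real_derivative gain_deriv z / gain z - elasticity x / z) (at z)"
      unfolding \<phi>_def using z01 gain_bounds[OF z01]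
      by (auto intro!: derivative_eq_intros has_real_derivative_gain)
    moreover have "gain_deriv z / gain z - elasticity x / z = (elasticity z - elasticity x) / z"
      using z01 by (simp add: elasticity_def field_simps)
    moreover have "elasticity z \<le> elasticity x"
      using elasticity_strict_antimono[OF M xy(1), of z] z z01 by (cases "x = z") auto
    ultimately show "\<exists>d. (\<phi> has_real_derivative d) (at z) \<and> d \<le> 0"
      using z01 by (intro exI[of _ "(elasticity z - elasticity x) / z"])
        (auto simp: divide_nonpos_pos)
  qed (use xy in auto)
  then have "ln (gain y) - ln y * elasticity x \<le> tangent_offset x"
    by (simp add: \<phi>_def tangent_offset_def mult.commute)
  \<comment> \<open>Unfreezing the slope at \<open>y\<close> lowers the value strictly, since
    \<open>- ln y\<close> is positive.\<close>
  moreover have "tangent_offset y < ln (gain y) - ln y * elasticity x"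
    using xy elasticity_strict_antimono[OF M, of x y] by (simp add: tangent_offset_def)
  ultimately show ?thesis by linarith
qed

text \<open>Taking the factor \<open>z\<close> out of the gain cancels the divergent
  \<open>ln z\<close>; what remains has a finite limit at 0.\<close>

lemma tangent_offset_eq:
  assumes "0 < z" "z \<le> 1"
  shows "tangent_offset z =
    ln (\<beta> * \<gamma> * (\<Sum>k<M. (1 - \<gamma> * z) ^ k)) + ln z * (1 - elasticity z)"
proof -
  have "gain z = \<beta> * \<gamma> * (\<Sum>k<M. (1 - \<gamma> * z) ^ k) * z"
    by (simp add: gain_eq_sum mult_ac)
  then have "ln (gain z) = ln (\<beta> * \<gamma> * (\<Sum>k<M. (1 - \<gamma> * z) ^ k)) + ln z"
    using sum_power_pos[OF assms] \<beta>_pos \<gamma>_pos assms by (simp add: ln_mult_pos)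
  then show ?thesis by (simp add: tangent_offset_def algebra_simps)
qed

text \<open>The bound is the limit of the offset at 0, so its sign limits when a root can
  exist.\<close>

lemma tangent_offset_le:
  assumes "0 < z" "z \<le> 1"
  shows "tangent_offset z \<le> ln (\<beta> * \<gamma> * real M)"
proof -
  have "(\<Sum>k<M. (1 - \<gamma> * z) ^ k) \<le> (\<Sum>k<M. 1)"
    using \<gamma>z_bounds[OF assms] by (intro sum_mono power_le_one) auto
  then have "ln (\<beta> * \<gamma> * (\<Sum>k<M. (1 - \<gamma> * z) ^ k)) \<le> ln (\<beta> * \<gamma> * real M)"
    using sum_power_pos[OF assms] \<beta>_pos \<gamma>_pos M_pos by simp
  moreover have "ln z * (1 - elasticity z) \<le> 0"
    using assms elasticity_le_1[OF assms] by (intro mult_nonpos_nonneg) auto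
  ultimately show ?thesis using tangent_offset_eq[OF assms] by simp
qed

text \<open>The left-hand side tends to \<open>ln (\<beta> * \<gamma> * real M)\<close> at 0, which
  yields points of positive offset when that limit is positive.\<close>

lemma tangent_offset_ge:
  assumes "0 < z" "z \<le> 1"
  shows "ln (\<beta> * \<gamma> * real M * (1 - \<gamma> * z) ^ (M - 1)) + real M * (z * ln z) \<le> tangent_offset z"
proof -
  have "0 < real M * (1 - \<gamma> * z) ^ (M - 1)"
    using M_pos \<gamma>z_bounds[OF assms] by simp
  then have "0 < \<beta> * \<gamma> * (real M * (1 - \<gamma> * z) ^ (M - 1))"
    using \<beta>_pos \<gamma>_pos by (simp only: mult_pos_pos)
  then have "ln (\<beta> * \<gamma> * (real M * (1 - \<gamma> * z) ^ (M - 1))) \<le> ln (\<beta> * \<gamma> * (\<Sum>k<M. (1 - \<gamma> * z) ^ k))"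
    using sum_power_ge[OF assms] \<beta>_pos \<gamma>_pos by (intro ln_mono mult_left_mono) auto
  moreover have "ln z * (real M * z) \<le> ln z * (1 - elasticity z)"
    using assms elasticity_ge[OF assms] by (intro mult_left_mono_neg) auto
  ultimately show ?thesis using tangent_offset_eq[OF assms] by (simp add: mult_ac)
qed

lemma continuous_on_tangent_offset: "continuous_on {0<..1} tangent_offset"
proof -
  have "continuous_on {0<..1} gain" "continuous_on {0<..1} gain_deriv"
    unfolding gain_def[abs_def] gain_deriv_def[abs_def] by (intro continuous_intros)+
  then show ?thesis
    unfolding tangent_offset_def[abs_def] elasticity_def[abs_def]
    using gain_bounds by (intro continuous_intros) (auto simp: order_less_imp_not_eq2)
qed

section \<open>Solvability of the transcendental equation\<close>

lemma transcendental_root_iff: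
  "transcendental_root \<beta> \<gamma> M z \<longleftrightarrow> 0 < z \<and> z < 1 \<and> gain z * ln (gain z) = ln z * (z * gain_deriv z)"
proof -
  have "gain z * ln (gain z) = ln z * (z * gain_deriv z) \<longleftrightarrow>
      \<beta> * ((1 - (1 - \<gamma> * z) ^ M) * ln (gain z)) =
      \<beta> * (\<gamma> * real M * z * ln z * (1 - \<gamma> * z) ^ (M - 1))"
    by (simp add: gain_def gain_deriv_def mult_ac)
  also have "\<dots> \<longleftrightarrow> (1 - (1 - \<gamma> * z) ^ M) * ln (gain z) =
      \<gamma> * real M * z * ln z * (1 - \<gamma> * z) ^ (M - 1)"
    using \<beta>_pos by simp
  finally show ?thesis by (simp add: transcendental_root_def gain_def)
qed

lemma transcendental_root_iff_tangent_offset: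
  "transcendental_root \<beta> \<gamma> M z \<longleftrightarrow> 0 < z \<and> z < 1 \<and> tangent_offset z = 0"
  using gain_bounds(1)[of z] transcendental_root_iff[of z]
  by (auto simp: tangent_offset_def elasticity_def field_simps)

text \<open>For a single mode the upper bound on the offset is
  \<open>ln (\<beta> * \<gamma>) < 0\<close>. Hence strict monotonicity is available as soon as a
  root exists.\<close>

lemma transcendental_root_imp_two_modes:
  assumes "transcendental_root \<beta> \<gamma> M z"
  shows "2 \<le> M"
proof (rule ccontr)
  assume "\<not> 2 \<le> M"
  then have M: "M = 1" using M_pos by simp
  have z: "0 < z" "z < 1" "tangent_offset z = 0"
    using assms by (auto simp: transcendental_root_iff_tangent_offset)
  have "tangent_offset z \<le> ln (\<beta> * \<gamma>)" using tangent_offset_le[of z] z M by simp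
  moreover have "\<beta> * \<gamma> < 1 * 1"
    using \<beta>_pos \<beta>_less_1 \<gamma>_pos \<gamma>_less_1 by (intro mult_strict_mono) auto
  then have "ln (\<beta> * \<gamma>) < 0" using \<beta>_pos \<gamma>_pos by simp
  ultimately show False using z by simp
qed

lemma transcendental_root_unique:
  assumes "transcendental_root \<beta> \<gamma> M x" "transcendental_root \<beta> \<gamma> M y"
  shows "x = y"
  using assms transcendental_root_imp_two_modes[OF assms(1)]
    tangent_offset_strict_antimono[of x y] tangent_offset_strict_antimono[of y x]
  by (cases x y rule: linorder_cases) (auto simp: transcendental_root_iff_tangent_offset)

lemma transcendental_root_imp_slope:
  assumes "transcendental_root \<beta> \<gamma> M z"
  shows "1 < \<beta> * \<gamma> * real M"
proof -
  have z: "0 < z" "z < 1" "tangent_offset z = 0"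
    using assms by (auto simp: transcendental_root_iff_tangent_offset)
  \<comment> \<open>At the root itself the upper bound would give only a weak inequality; a point to
    its left, where the offset is positive, makes it strict.\<close>
  have "0 < tangent_offset (z / 2)"
    using tangent_offset_strict_antimono[OF transcendental_root_imp_two_modes[OF assms], of "z / 2" z] z
    by simp
  also have "\<dots> \<le> ln (\<beta> * \<gamma> * real M)" using z by (intro tangent_offset_le) auto
  finally show ?thesis using \<beta>_pos \<gamma>_pos M_pos by simp
qed

lemma transcendental_root_exists:
  assumes "1 < \<beta> * \<gamma> * real M"
  shows "\<exists>z. transcendental_root \<beta> \<gamma> M z"
proof -
  have "((\<lambda>z::real. z * ln z) \<longlongrightarrow> 0) (at_right 0)"
    by real_asymp
  then have "((\<lambda>z. ln (\<beta> * \<gamma> * real M * (1 - \<gamma> * z) ^ (M - 1)) + real M * (z * ln z)) \<longlongrightarrow>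
      ln (\<beta> * \<gamma> * real M * (1 - \<gamma> * 0) ^ (M - 1)) + real M * 0) (at_right 0)"
    using assms M_pos by (intro tendsto_intros) auto
  then have "\<forall>\<^sub>F z in at_right 0.
      0 < ln (\<beta> * \<gamma> * real M * (1 - \<gamma> * z) ^ (M - 1)) + real M * (z * ln z)"
    using assms M_pos by (intro order_tendstoD(1)) auto
  moreover have "\<forall>\<^sub>F z in at_right 0. (0::real) < z \<and> z < 1"
    unfolding eventually_at_right_field by (intro exI[of _ 1]) simp
  ultimately have "\<forall>\<^sub>F z in at_right 0. 0 < z \<and> z < 1 \<and> 0 < tangent_offset z"
    by eventually_elim (use tangent_offset_ge in force)
  then obtain a where a: "0 < a" "a < 1" "0 < tangent_offset a"
    using eventually_happens'[OF trivial_limit_at_right_real] by blast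
  \<comment> \<open>At \<open>z = 1\<close> the slope term drops out because
    \<open>ln 1 = 0\<close>, leaving the negative \<open>ln (gain 1)\<close>.\<close>
  have end_neg: "tangent_offset 1 < 0"
    using gain_bounds[of 1] by (simp add: tangent_offset_def)
  have "continuous_on {a..1} tangent_offset"
    by (rule continuous_on_subset[OF continuous_on_tangent_offset]) (use a in auto)
  then obtain z where z: "a \<le> z" "z \<le> 1" "tangent_offset z = 0"
    using IVT2'[of tangent_offset 1 0 a] a end_neg by auto
  then have "z \<noteq> 1" using end_neg by auto
  with z a show ?thesis
    by (intro exI[of _ z]) (auto simp: transcendental_root_iff_tangent_offset)
qed

text \<open>Uniqueness is unconditional, so only existence is at stake, and the sign of the limit of
  the offset at 0 decides it.\<close>

lemma ex1_transcendental_root_iff: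
  "(\<exists>!z. transcendental_root \<beta> \<gamma> M z) \<longleftrightarrow> 1 < \<beta> * \<gamma> * real M"
  using transcendental_root_exists transcendental_root_imp_slope transcendental_root_unique by blast

section \<open>Envelope conditions and the closed form of the rate\<close>

lemma rate_family_envelope_conditions_iff:
  assumes A: "0 < A" and y: "0 < y" and t: "0 < t" and x: "0 < x" "x < 1"
  shows "rate_family A \<beta> \<gamma> M x y t = 0 \<and>
      (rate_family A \<beta> \<gamma> M x y has_real_derivative 0) (at t) \<longleftrightarrow>
    transcendental_root \<beta> \<gamma> M (x powr t) \<and> ln (y / A) * t = ln (gain (x powr t))"
proof -
  define z where "z = x powr t"
  have z: "0 < z" "z < 1" "ln z = t * ln x"
    using x t powr_less_mono2[of t x 1] by (auto simp: z_def ln_powr)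
  have g: "0 < gain z" using gain_bounds z by simp
  have yA: "0 < y / A" using y A by simp
  have "((\<lambda>s. (y / A) powr s - gain (x powr s)) has_real_derivative
      (y / A) powr t * ln (y / A) - gain_deriv z * (z * ln x)) (at t)"
    unfolding z_def
    by (intro DERIV_diff DERIV_chain'[OF _ has_real_derivative_gain])
      (use x yA in \<open>auto intro!: derivative_eq_intros\<close>)
  moreover have "rate_family A \<beta> \<gamma> M x y = (\<lambda>s. (y / A) powr s - gain (x powr s))"
    by (simp add: rate_family_def gain_def fun_eq_iff)
  ultimately have "(rate_family A \<beta> \<gamma> M x y has_real_derivative
      (y / A) powr t * ln (y / A) - gain_deriv z * (z * ln x)) (at t)"
    by simp
  then have deriv: "(rate_family A \<beta> \<gamma> M x y has_real_derivative 0) (at t) \<longleftrightarrow>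
      (y / A) powr t * ln (y / A) = gain_deriv z * (z * ln x)"
    by (auto dest: DERIV_unique)
  have zero: "rate_family A \<beta> \<gamma> M x y t = 0 \<longleftrightarrow> (y / A) powr t = gain z"
    by (simp add: rate_family_def gain_def z_def)
  have log_zero: "(y / A) powr t = gain z \<longleftrightarrow> ln (y / A) * t = ln (gain z)"
  proof -
    have "(y / A) powr t = gain z \<longleftrightarrow> ln ((y / A) powr t) = ln (gain z)"
      using yA g by (subst ln_inj_iff) auto
    then show ?thesis using yA by (simp add: ln_powr mult.commute)
  qed
  \<comment> \<open>Multiplied by \<open>t\<close>, the derivative condition involves
    \<open>x\<close> and \<open>y\<close> only through \<open>t * ln x = ln z\<close> and
    \<open>t * ln (y / A) = ln (gain z)\<close>, and so becomes the transcendental equation.\<close>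
  have "gain z * ln (y / A) = gain_deriv z * (z * ln x) \<longleftrightarrow> transcendental_root \<beta> \<gamma> M z"
    if "ln (y / A) * t = ln (gain z)"
  proof -
    have "transcendental_root \<beta> \<gamma> M z \<longleftrightarrow>
        t * (gain z * ln (y / A)) = t * (gain_deriv z * (z * ln x))"
      unfolding transcendental_root_iff that[symmetric] z(3) using z(1,2) by (simp add: mult_ac)
    then show ?thesis using t by simp
  qed
  then show ?thesis
    unfolding deriv zero z_def[symmetric] using log_zero by auto
qed

lemma on_envelope_iff:
  assumes A: "0 < A" and x: "0 < x" "x < 1" and T: "T \<subseteq> {0<..}"
    and root: "transcendental_root \<beta> \<gamma> M z"
  shows "on_envelope A \<beta> \<gamma> M T x y \<longleftrightarrow>
    ln z / ln x \<in> T \<and> y = A * x powr rate_exponent \<beta> \<gamma> M z"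
proof -
  define s where "s = ln z / ln x"
  have z: "0 < z" "z < 1" using root by (auto simp: transcendental_root_def)
  have lx: "ln x < 0" and lz: "ln z < 0" using x z by auto
  then have s: "0 < s" by (simp add: s_def divide_neg_neg)
  have \<xi>: "rate_exponent \<beta> \<gamma> M z = ln (gain z) / ln z"
    by (simp add: rate_exponent_def gain_def)
  have xt: "x powr t = z \<longleftrightarrow> t = s" for t
  proof -
    have "x powr t = z \<longleftrightarrow> ln (x powr t) = ln z"
      using x z by (subst ln_inj_iff) auto
    also have "\<dots> \<longleftrightarrow> t = s" using x lx by (auto simp: ln_powr s_def field_simps)
    finally show ?thesis .
  qed
  have rate: "ln (y / A) * s = ln (gain z) \<longleftrightarrow> y = A * x powr rate_exponent \<beta> \<gamma> M z" if y: "0 < y" for y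
  proof -
    have "ln (y / A) * s = ln (gain z) \<longleftrightarrow> ln (y / A) = rate_exponent \<beta> \<gamma> M z * ln x"
      using lx lz by (simp add: \<xi> s_def field_simps)
    also have "\<dots> \<longleftrightarrow> ln (y / A) = ln (x powr rate_exponent \<beta> \<gamma> M z)"
      using x by (simp add: ln_powr)
    also have "\<dots> \<longleftrightarrow> y / A = x powr rate_exponent \<beta> \<gamma> M z"
      using x y A by (subst ln_inj_iff) auto
    also have "\<dots> \<longleftrightarrow> y = A * x powr rate_exponent \<beta> \<gamma> M z"
      using A by (auto simp: field_simps)
    finally show ?thesis .
  qed
  have "on_envelope A \<beta> \<gamma> M T x y \<longleftrightarrow>
      0 < y \<and> (\<exists>t\<in>T. transcendental_root \<beta> \<gamma> M (x powr t) \<and> ln (y / A) * t = ln (gain (x powr t)))"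
    unfolding on_envelope_def
    by (rule conj_cong[OF refl], rule bex_cong[OF refl], rule rate_family_envelope_conditions_iff)
      (use A x T in auto)
  also have "\<dots> \<longleftrightarrow> 0 < y \<and> s \<in> T \<and> ln (y / A) * s = ln (gain z)"
    using root transcendental_root_unique[OF _ root] xt by metis
  also have "\<dots> \<longleftrightarrow> s \<in> T \<and> y = A * x powr rate_exponent \<beta> \<gamma> M z"
    using rate[of y] A x by (cases "0 < y") auto
  finally show ?thesis by (simp add: s_def)
qed

end

theorem theorem5:
  fixes M :: nat
    and \<alpha> T\<^sub>q \<eta>\<^sub>e \<eta>\<^sub>r \<eta>\<^sub>d lam\<^sub>m A \<beta> \<gamma> :: real
  assumes "1 \<le> M" and "0 < \<alpha>" and "0 < T\<^sub>q"
    and "0 < \<eta>\<^sub>e" "\<eta>\<^sub>e \<le> 1"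
    and "0 < \<eta>\<^sub>r" "\<eta>\<^sub>r \<le> 1"
    and "0 < \<eta>\<^sub>d" "\<eta>\<^sub>d \<le> 1"
    and "0 < lam\<^sub>m" "lam\<^sub>m \<le> 1"
    and "\<beta> = \<eta>\<^sub>r\<^sup>2 * lam\<^sub>m\<^sup>2 / 2"
    and "\<gamma> = \<eta>\<^sub>e\<^sup>2 / 2"
    and "A = \<eta>\<^sub>d\<^sup>2 / (\<eta>\<^sub>r\<^sup>2 * lam\<^sub>m\<^sup>2 * T\<^sub>q)"
  shows "((\<exists>!z. transcendental_root \<beta> \<gamma> M z) \<longleftrightarrow> 1 < \<beta> * \<gamma> * real M) \<and>
         (\<forall>z L \<eta> \<xi>. transcendental_root \<beta> \<gamma> M z \<and> 0 < L \<and>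
            \<eta> = exp (- \<alpha> * L) \<and> \<xi> = rate_exponent \<beta> \<gamma> M z \<longrightarrow>
            (\<forall>y. on_envelope A \<beta> \<gamma> M {0<..1} \<eta> y \<longleftrightarrow> \<eta> \<le> z \<and> y = A * \<eta> powr \<xi>) \<and>
            (\<eta> \<le> z \<longrightarrow> envelope_rate A \<beta> \<gamma> M {0<..1} \<alpha> L = A * \<eta> powr \<xi>) \<and>
            (\<forall>y. on_envelope A \<beta> \<gamma> M {0<..} \<eta> y \<longleftrightarrow> y = A * \<eta> powr \<xi>) \<and>
            envelope_rate A \<beta> \<gamma> M {0<..} \<alpha> L = A * \<eta> powr \<xi>)"
proof -
  have \<beta>: "0 < \<beta>" "\<beta> \<le> 1 / 2"
  proof -
    show "0 < \<beta>" unfolding \<open>\<beta> = _\<close> using assms(6,10) by simp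
    have "\<eta>\<^sub>r\<^sup>2 * lam\<^sub>m\<^sup>2 \<le> 1 * 1"
      using assms by (intro mult_mono power_le_one) auto
    then show "\<beta> \<le> 1 / 2" using assms by simp
  qed
  have \<gamma>: "0 < \<gamma>" "\<gamma> \<le> 1 / 2"
    unfolding \<open>\<gamma> = _\<close> using assms(4,5) by (simp_all add: power_le_one)
  have A: "0 < A" unfolding \<open>A = _\<close> using assms(3,6,8,10) by simp
  interpret link_gain \<beta> \<gamma> M
    using \<beta> \<gamma> assms(1) by unfold_locales auto
  show ?thesis
  proof (rule conjI[OF ex1_transcendental_root_iff], intro allI impI, elim conjE)
    fix z L \<eta> \<xi> :: real
    assume root: "transcendental_root \<beta> \<gamma> M z" and L: "0 < L"
      and \<eta>: "\<eta> = exp (- \<alpha> * L)" and \<xi>: "\<xi> = rate_exponent \<beta> \<gamma> M z"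
    have x: "0 < \<eta>" "\<eta> < 1" using L assms(2) \<eta> by auto
    have z: "0 < z" "z < 1" using root by (auto simp: transcendental_root_def)
    note env = on_envelope_iff[OF A x _ root, folded \<xi>]
    have pos: "0 < ln z / ln \<eta>" using x z by (simp add: divide_neg_neg)
    \<comment> \<open>The inequality flips because \<open>ln \<eta>\<close> is negative.\<close>
    have "ln z / ln \<eta> \<le> 1 \<longleftrightarrow> ln \<eta> \<le> ln z" using x by (simp add: neg_divide_le_eq)
    then have "ln z / ln \<eta> \<le> 1 \<longleftrightarrow> \<eta> \<le> z" using x z by simp
    then have env1: "on_envelope A \<beta> \<gamma> M {0<..1} \<eta> y \<longleftrightarrow> \<eta> \<le> z \<and> y = A * \<eta> powr \<xi>" for y
      using env[of "{0<..1}" y] pos by (auto simp: subset_iff)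
    have env2: "on_envelope A \<beta> \<gamma> M {0<..} \<eta> y \<longleftrightarrow> y = A * \<eta> powr \<xi>" for y
      using env[of "{0<..}" y] pos by (auto simp: subset_iff)
    show "(\<forall>y. on_envelope A \<beta> \<gamma> M {0<..1} \<eta> y \<longleftrightarrow> \<eta> \<le> z \<and> y = A * \<eta> powr \<xi>) \<and>
        (\<eta> \<le> z \<longrightarrow> envelope_rate A \<beta> \<gamma> M {0<..1} \<alpha> L = A * \<eta> powr \<xi>) \<and>
        (\<forall>y. on_envelope A \<beta> \<gamma> M {0<..} \<eta> y \<longleftrightarrow> y = A * \<eta> powr \<xi>) \<and>
        envelope_rate A \<beta> \<gamma> M {0<..} \<alpha> L = A * \<eta> powr \<xi>"
      using env1 env2 by (simp add: envelope_rate_def del: mult_minus_left flip: \<eta>)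
  qed
qed

end
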